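(* Let $Q=(q_n)$ and $S=(s_n)$ be basic sequences. Suppose that $Q$ is infinite in limit and $$\log q_k=o\left(\sum_{n=1}^{k-1}\log q_n\right)\quad (k\to\infty).$$ Then the set $\Theta_{Q,S}$ has Hausdorff dimension $1$: $\dim_{\mathrm H}(\Theta_{Q,S})=1$.
   Context: A basic sequence is a sequence $Q=(q_n)_{n=1}^\infty$ of integers $q_n\ge 2$; it is infinite in limit if $q_n\to\infty$. Construction of $\Theta_{Q,S}$, for basic sequences $Q=(q_n)$ (infinite in limit) and $S=(s_n)$. Empty products are $1$ and empty sums are $0$. Let $S_j=\prod_{k=1}^{j-1}s_k$ (so $S_1=1$), and let $\nu_j$ be the least positive integer $t$ such that $q_m\ge S_j^{2j}$ for all $m\ge t$. Put $l_1=s_1\nu_2$, $L_0=0$, $L_j=\sum_{k=1}^j S_kl_k$, and for $j\ge2$ recursively $$l_j=\frac{L_{j-1}\,(2js_j\nu_{j+1}-1)}{S_j}$$ (these are positive integers). Let $\mathscr U=\{(j,b,c)\in\mathbb N^3: b\le l_j,\ c\le S_j\}$ with $\mathbb N=\{1,2,\dots\}$, and $\phi(j,b,c)=L_{j-1}+(b-1)S_j+c$, which is a bijection $\mathscr U\to\mathbb N$. Let $\mathscr F$ be the set of all families $F=(F_{(j,b,c)})_{(j,b,c)\in\mathscr U}$ of positive integers such that $F_{(j,b,c)}/q_{\phi(j,b,c)}\in V_{j,b,c}$ for all $(j,b,c)\in\mathscr U$, where $$V_{1,b,c}=\left[\frac{1}{q_{\phi(1,b,c)}},\frac{2}{q_{\phi(1,b,c)}}\right),\qquad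 V_{j,b,c}=\left[\frac{c}{S_j}+\frac1{S_j^2},\ \frac{c}{S_j}+\frac{2}{S_j^2}\right]\ \text{ for } j>1.$$ For $F\in\mathscr F$ put $E_{F,n}=F_{\phi^{-1}(n)}$ and let $x_F$ be the sum of the series $x_F=\sum_{n=1}^\infty\frac{E_{F,n}}{q_1q_2\cdots q_n}$. Then $\Theta_{Q,S}=\{x_F:F\in\mathscr F\}$. *)

theory Defs
  imports "HOL-Analysis.Analysis" "HOL-Library.Landau_Symbols"
begin

text \<open>
  The library's \<open>diameter\<close> is meaningful only for bounded sets, hence the explicit boundedness
  of the covering sets. The convention for \<open>s = 0\<close> is that every nonempty set contributes 1
  (whereas \<open>0 powr 0 = 0\<close>).
\<close>

definition diam_pow :: "real \<Rightarrow> 'a::metric_space set \<Rightarrow> ennreal" where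
  "diam_pow s U =
     (if U = {} then 0 else if s = 0 then 1 else ennreal (diameter U powr s))"

definition delta_covers :: "real \<Rightarrow> 'a::metric_space set \<Rightarrow> (nat \<Rightarrow> 'a set) set" where
  "delta_covers \<delta> A =
     {U. A \<subseteq> (\<Union>i. U i) \<and> (\<forall>i. bounded (U i) \<and> diameter (U i) \<le> \<delta>)}"

definition hausdorff_premeasure :: "real \<Rightarrow> real \<Rightarrow> 'a::metric_space set \<Rightarrow> ennreal" where
  "hausdorff_premeasure s \<delta> A = (INF U\<in>delta_covers \<delta> A. \<Sum>i. diam_pow s (U i))"

definition hausdorff_measure :: "real \<Rightarrow> 'a::metric_space set \<Rightarrow> ennreal" where
  "hausdorff_measure s A = (SUP \<delta>\<in>{0<..}. hausdorff_premeasure s \<delta> A)"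

definition hausdorff_dim :: "'a::metric_space set \<Rightarrow> ennreal" where
  "hausdorff_dim A = Inf (ennreal ` {s. 0 \<le> s \<and> hausdorff_measure s A = 0})"

text \<open>Sequences are indexed from 1; the value at index 0 is irrelevant throughout.\<close>

definition basic_sequence :: "(nat \<Rightarrow> nat) \<Rightarrow> bool" where
  "basic_sequence q \<longleftrightarrow> (\<forall>n\<ge>1. q n \<ge> 2)"

definition infinite_in_limit :: "(nat \<Rightarrow> nat) \<Rightarrow> bool" where
  "infinite_in_limit q \<longleftrightarrow> filterlim q at_top sequentially"

definition Sprod :: "(nat \<Rightarrow> nat) \<Rightarrow> nat \<Rightarrow> nat" where
  "Sprod s j = (\<Prod>k=1..<j. s k)"

definition nu :: "(nat \<Rightarrow> nat) \<Rightarrow> (nat \<Rightarrow> nat) \<Rightarrow> nat \<Rightarrow> nat" where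
  "nu q s j = (LEAST t. t \<ge> 1 \<and> (\<forall>m\<ge>t. q m \<ge> Sprod s j ^ (2 * j)))"

text \<open>
  The sum in the recursive case is $L_{j-1}$. The division and the subtraction are exact, see
  \<open>Sprod_mult_blk_len\<close> and \<open>blk_len_pos\<close> below.
\<close>

function blk_len :: "(nat \<Rightarrow> nat) \<Rightarrow> (nat \<Rightarrow> nat) \<Rightarrow> nat \<Rightarrow> nat" where
  "blk_len q s j =
     (if j = 0 then 0
      else if j = 1 then s 1 * nu q s 2
      else (\<Sum>k\<in>{1..j-1}. Sprod s k * blk_len q s k) * (2 * j * s j * nu q s (j + 1) - 1)
           div Sprod s j)"
  by pat_completeness auto
termination
  by (relation "Wellfounded.measure (\<lambda>(q, s, j). j)") auto

declare blk_len.simps [simp del]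

definition blk_end :: "(nat \<Rightarrow> nat) \<Rightarrow> (nat \<Rightarrow> nat) \<Rightarrow> nat \<Rightarrow> nat" where
  "blk_end q s j = (\<Sum>k=1..j. Sprod s k * blk_len q s k)"

definition index_set :: "(nat \<Rightarrow> nat) \<Rightarrow> (nat \<Rightarrow> nat) \<Rightarrow> (nat \<times> nat \<times> nat) set" where
  "index_set q s =
     {(j, b, c). 1 \<le> j \<and> 1 \<le> b \<and> 1 \<le> c \<and> b \<le> blk_len q s j \<and> c \<le> Sprod s j}"

definition phi :: "(nat \<Rightarrow> nat) \<Rightarrow> (nat \<Rightarrow> nat) \<Rightarrow> nat \<times> nat \<times> nat \<Rightarrow> nat" where
  "phi q s = (\<lambda>(j, b, c). blk_end q s (j - 1) + (b - 1) * Sprod s j + c)"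

definition V :: "(nat \<Rightarrow> nat) \<Rightarrow> (nat \<Rightarrow> nat) \<Rightarrow> nat \<times> nat \<times> nat \<Rightarrow> real set" where
  "V q s = (\<lambda>(j, b, c).
     if j = 1 then {1 / real (q (phi q s (j, b, c))) ..< 2 / real (q (phi q s (j, b, c)))}
     else {real c / real (Sprod s j) + 1 / real (Sprod s j) ^ 2 ..
           real c / real (Sprod s j) + 2 / real (Sprod s j) ^ 2})"

text \<open>Values of a family outside the index set are unconstrained and never used.\<close>

definition families :: "(nat \<Rightarrow> nat) \<Rightarrow> (nat \<Rightarrow> nat) \<Rightarrow> (nat \<times> nat \<times> nat \<Rightarrow> nat) set" where
  "families q s =
     {F. \<forall>u\<in>index_set q s. F u \<ge> 1 \<and> real (F u) / real (q (phi q s u)) \<in> V q s u}"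

definition digit ::
    "(nat \<Rightarrow> nat) \<Rightarrow> (nat \<Rightarrow> nat) \<Rightarrow> (nat \<times> nat \<times> nat \<Rightarrow> nat) \<Rightarrow> nat \<Rightarrow> nat" where
  "digit q s F n = F (inv_into (index_set q s) (phi q s) n)"

text \<open>The shift by \<open>Suc\<close> makes the series start at index 1.\<close>

definition x_of ::
    "(nat \<Rightarrow> nat) \<Rightarrow> (nat \<Rightarrow> nat) \<Rightarrow> (nat \<times> nat \<times> nat \<Rightarrow> nat) \<Rightarrow> real" where
  "x_of q s F = (\<Sum>n. real (digit q s F (Suc n)) / (\<Prod>k=1..Suc n. real (q k)))"

definition Theta :: "(nat \<Rightarrow> nat) \<Rightarrow> (nat \<Rightarrow> nat) \<Rightarrow> real set" where
  "Theta q s = x_of q s ` families q s"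


lemma Sprod_pos: "basic_sequence s \<Longrightarrow> Sprod s j > 0"
  unfolding Sprod_def basic_sequence_def by (intro prod_pos) fastforce

lemma nu_spec:
  assumes "infinite_in_limit q"
  shows "nu q s j \<ge> 1 \<and> (\<forall>m\<ge>nu q s j. q m \<ge> Sprod s j ^ (2 * j))"
proof -
  obtain N where "\<forall>m\<ge>N. q m \<ge> Sprod s j ^ (2 * j)"
    using assms unfolding infinite_in_limit_def filterlim_at_top eventually_sequentially by blast
  then have "max N 1 \<ge> 1 \<and> (\<forall>m\<ge>max N 1. q m \<ge> Sprod s j ^ (2 * j))" by auto
  then show ?thesis unfolding nu_def by (rule LeastI)
qed

lemma blk_end_0 [simp]: "blk_end q s 0 = 0"
  by (simp add: blk_end_def)

lemma blk_end_Suc: "blk_end q s (Suc j) = blk_end q s j + Sprod s (Suc j) * blk_len q s (Suc j)"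
  by (simp add: blk_end_def)

lemma blk_len_1: "blk_len q s 1 = s 1 * nu q s 2"
  by (subst blk_len.simps) simp

lemma blk_len_rec:
  "j \<ge> 2 \<Longrightarrow> blk_len q s j =
     blk_end q s (j - 1) * (2 * j * s j * nu q s (j + 1) - 1) div Sprod s j"
  by (subst blk_len.simps) (simp add: blk_end_def)

lemma Sprod_Suc: "j \<ge> 1 \<Longrightarrow> Sprod s (Suc j) = Sprod s j * s j"
  by (simp add: Sprod_def prod.atLeastLessThan_Suc)

lemma blk_end_props:
  assumes "basic_sequence s" "infinite_in_limit q" "j \<ge> 1"
  shows "blk_end q s j > 0 \<and> Sprod s (Suc j) dvd blk_end q s j"
  using assms(3)
proof (induction j rule: nat_induct_at_least)
  case base
  have "s 1 > 0" using assms(1) unfolding basic_sequence_def by (metis le_refl not_numeral_le_zero zero_less_iff_neq_zero)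
  moreover have "nu q s 2 > 0" using nu_spec[OF assms(2), of s 2] by simp
  ultimately show ?case using blk_len_1[of q s]
    by (simp add: blk_end_def Sprod_def)
next
  case (Suc n)
  let ?k = "2 * Suc n * s (Suc n) * nu q s (Suc n + 1)"
  have "s (Suc n) > 0" using assms(1) unfolding basic_sequence_def
    by (metis Suc_le_mono le0 not_numeral_le_zero zero_less_iff_neq_zero One_nat_def)
  moreover have "nu q s (Suc n + 1) > 0" using nu_spec[OF assms(2), of s "Suc n + 1"] by simp
  ultimately have k: "?k > 0" by simp
  have l: "blk_len q s (Suc n) = blk_end q s n * (?k - 1) div Sprod s (Suc n)"
    using blk_len_rec[of "Suc n" q s] Suc.hyps by simp
  have "Sprod s (Suc n) * blk_len q s (Suc n) = blk_end q s n * (?k - 1)"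
    unfolding l using Suc.IH by (meson dvd_mult2 dvd_mult_div_cancel)
  then have "blk_end q s (Suc n) = blk_end q s n * (1 + (?k - 1))"
    by (simp only: blk_end_Suc distrib_left mult_1_right)
  also have "1 + (?k - 1) = ?k" using k by simp
  finally have eq: "blk_end q s (Suc n) = blk_end q s n * ?k" .
  have "Sprod s (Suc (Suc n)) dvd blk_end q s (Suc n)"
    unfolding eq Sprod_Suc[of "Suc n" s, simplified]
    using Suc.IH by (intro mult_dvd_mono) auto
  then show ?case using eq k Suc.IH by simp
qed

lemma Sprod_mult_blk_len:
  assumes "basic_sequence s" "infinite_in_limit q" "j \<ge> 2"
  shows "Sprod s j * blk_len q s j =
    blk_end q s (j - 1) * (2 * j * s j * nu q s (j + 1) - 1)"
  using blk_end_props[OF assms(1,2), of "j - 1"] assms(3)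
  by (simp add: blk_len_rec)

lemma blk_len_pos:
  assumes "basic_sequence s" "infinite_in_limit q" "j \<ge> 1"
  shows "blk_len q s j > 0"
proof -
  have s: "s j > 0" using assms(1,3) unfolding basic_sequence_def by fastforce
  show ?thesis
  proof (cases "j = 1")
    case True
    then show ?thesis using s nu_spec[OF assms(2), of s 2] blk_len_1[of q s] by simp
  next
    case False
    then have j: "j \<ge> 2" using assms(3) by simp
    have "1 * 1 \<le> s j * nu q s (j + 1)"
      using s nu_spec[OF assms(2), of s "j + 1"] by (intro mult_le_mono) auto
    then have "2 * 1 \<le> (2 * j) * (s j * nu q s (j + 1))"
      using j by (intro mult_le_mono) auto
    then have "2 \<le> 2 * j * s j * nu q s (j + 1)" by (simp only: mult.assoc mult_1_right)
    then have "2 * j * s j * nu q s (j + 1) - 1 > 0" by linarith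
    moreover have "blk_end q s (j - 1) > 0" using blk_end_props[OF assms(1,2), of "j - 1"] j by simp
    ultimately have "Sprod s j * blk_len q s j > 0"
      unfolding Sprod_mult_blk_len[OF assms(1,2) j] by simp
    then show ?thesis by simp
  qed
qed

lemma phi_bij:
  assumes "basic_sequence s" "infinite_in_limit q"
  shows "bij_betw (phi q s) (index_set q s) {1..}"
proof -
  have Sp: "Sprod s j > 0" for j using Sprod_pos[OF assms(1)] .
  have mono: "i \<le> j \<Longrightarrow> blk_end q s i \<le> blk_end q s j" for i j
    unfolding blk_end_def by (intro sum_mono2) auto
  have rng: "blk_end q s (j - 1) < phi q s (j, b, c) \<and> phi q s (j, b, c) \<le> blk_end q s j"
    if u: "(j, b, c) \<in> index_set q s" for j b c
  proof -
    have "(b - 1) * Sprod s j + c \<le> (b - 1) * Sprod s j + Sprod s j"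
      using u by (simp add: index_set_def)
    also have "\<dots> = b * Sprod s j" using u by (cases b) (auto simp: index_set_def)
    also have "\<dots> \<le> Sprod s j * blk_len q s j" using u by (simp add: index_set_def)
    finally show ?thesis using u blk_end_Suc[of q s "j - 1"] by (auto simp: index_set_def phi_def)
  qed
  have inj: "inj_on (phi q s) (index_set q s)"
  proof (intro inj_onI, clarify)
    fix j b c j' b' c'
    assume u: "(j, b, c) \<in> index_set q s" and u': "(j', b', c') \<in> index_set q s"
      and eq: "phi q s (j, b, c) = phi q s (j', b', c')"
    have "\<not> j < j'" using rng[OF u] rng[OF u'] eq mono[of j "j' - 1"] by linarith
    moreover have "\<not> j' < j" using rng[OF u] rng[OF u'] eq mono[of j' "j - 1"] by linarith
    ultimately have j: "j' = j" by simp
    have e: "(b - 1) * Sprod s j + (c - 1) = (b' - 1) * Sprod s j + (c' - 1)"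
      using eq u u' unfolding j by (auto simp: phi_def index_set_def)
    have lt: "c - 1 < Sprod s j" "c' - 1 < Sprod s j"
      using u u' unfolding j by (auto simp: index_set_def)
    have "b - 1 = b' - 1" using arg_cong[OF e, of "\<lambda>x. x div Sprod s j"] lt by simp
    moreover have "c - 1 = c' - 1" using arg_cong[OF e, of "\<lambda>x. x mod Sprod s j"] lt by simp
    ultimately show "j = j' \<and> (b, c) = (b', c')" using j u u' by (auto simp: index_set_def)
  qed
  have "n \<in> phi q s ` index_set q s" if n: "n \<ge> 1" for n
  proof -
    have "j \<le> blk_end q s j" for j
    proof (induction j)
      case (Suc j)
      have "Sprod s (Suc j) * blk_len q s (Suc j) > 0"
        using Sp blk_len_pos[OF assms, of "Suc j"] by simp
      then show ?case using Suc blk_end_Suc[of q s j] by linarith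
    qed simp
    then have ex: "\<exists>j. n \<le> blk_end q s j" by blast
    define j where "j = (LEAST j. n \<le> blk_end q s j)"
    have j1: "n \<le> blk_end q s j" unfolding j_def using ex by (rule LeastI_ex)
    have j0: "j \<ge> 1" using j1 n by (cases j) auto
    have j2: "blk_end q s (j - 1) < n"
      using not_less_Least[of "j - 1" "\<lambda>j. n \<le> blk_end q s j"] j0 unfolding j_def by force
    define m where "m = n - blk_end q s (j - 1) - 1"
    have m: "m < blk_len q s j * Sprod s j"
      using j1 j2 j0 blk_end_Suc[of q s "j - 1"] by (simp add: m_def mult.commute)
    have "(j, m div Sprod s j + 1, m mod Sprod s j + 1) \<in> index_set q s"
      using j0 m Sp[of j] by (auto simp: index_set_def Suc_le_eq less_mult_imp_div_less)
    moreover have "phi q s (j, m div Sprod s j + 1, m mod Sprod s j + 1) = n"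
    proof -
      have "m div Sprod s j * Sprod s j + m mod Sprod s j = m" by (rule div_mult_mod_eq)
      moreover have "blk_end q s (j - 1) + m + 1 = n" using j2 by (simp add: m_def)
      ultimately show ?thesis by (simp add: phi_def)
    qed
    ultimately show ?thesis by force
  qed
  moreover have "phi q s ` index_set q s \<subseteq> {1..}" by (force simp: phi_def index_set_def)
  ultimately show ?thesis using inj unfolding bij_betw_def by auto
qed

lemma x_of_summable:
  assumes "basic_sequence q" "basic_sequence s" "infinite_in_limit q" "F \<in> families q s"
  shows "summable (\<lambda>n. real (digit q s F (Suc n)) / (\<Prod>k=1..Suc n. real (q k)))"
proof (rule summable_comparison_test')
  have q: "q n \<ge> 2" if "n \<ge> 1" for n using assms(1) that by (simp add: basic_sequence_def)
  show "summable (\<lambda>n. 3 * (1/2::real) ^ n)" by (intro summable_mult summable_geometric) simp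
  show "norm (real (digit q s F (Suc n)) / (\<Prod>k=1..Suc n. real (q k))) \<le> 3 * (1/2) ^ n"
    if "n \<ge> 0" for n
  proof -
    let ?u = "inv_into (index_set q s) (phi q s) (Suc n)"
    have im: "Suc n \<in> phi q s ` index_set q s"
      using phi_bij[OF assms(2,3)] by (auto simp: bij_betw_def)
    have u: "?u \<in> index_set q s" "phi q s ?u = Suc n"
      using inv_into_into[OF im] f_inv_into_f[OF im] by auto
    obtain j b c where jbc: "?u = (j, b, c)" by (cases ?u)
    have c: "c \<le> Sprod s j" using u(1) unfolding jbc by (simp add: index_set_def)
    have S: "real (Sprod s j) \<ge> 1" using Sprod_pos[OF assms(2), of j] by simp
    have "real (F ?u) / real (q (Suc n)) \<in> V q s ?u"
      using assms(4) u by (force simp: families_def)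
    moreover have "r \<le> 3" if "r \<in> V q s ?u" for r
    proof (cases "j = 1")
      case True
      have "2 / real (q (phi q s ?u)) \<le> 2 / 1"
        unfolding u(2) using q[of "Suc n"] by (intro divide_left_mono) auto
      then show ?thesis using that True unfolding jbc by (auto simp: V_def)
    next
      case False
      have "real c / real (Sprod s j) \<le> 1" using c S by simp
      moreover have "2 / real (Sprod s j) ^ 2 \<le> 2 / 1"
        using S by (intro divide_left_mono) (auto simp: one_le_power)
      ultimately show ?thesis using that False unfolding jbc by (auto simp: V_def)
    qed
    ultimately have d: "real (digit q s F (Suc n)) / real (q (Suc n)) \<le> 3"
      by (simp add: digit_def)
    have "(2::real) ^ n = (\<Prod>k=1..n. 2)" by simp
    also have "\<dots> \<le> (\<Prod>k=1..n. real (q k))" using q by (intro prod_mono) force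
    finally have P: "1 / (\<Prod>k=1..n. real (q k)) \<le> (1/2) ^ n"
      by (simp add: power_one_over frac_le)
    have "real (digit q s F (Suc n)) / (\<Prod>k=1..Suc n. real (q k)) =
        (real (digit q s F (Suc n)) / real (q (Suc n))) * (1 / (\<Prod>k=1..n. real (q k)))"
      by simp
    also have "\<dots> \<le> 3 * (1/2) ^ n"
      using d P by (intro mult_mono) (auto intro!: prod_nonneg)
    finally show ?thesis by (simp add: prod_nonneg abs_of_nonneg)
  qed
qed

end

theory Submission
  imports Defs
begin

text \<open>
  At position \<open>n\<close> choose \<open>N\<^sub>n \<le> q\<^sub>n\<close> consecutive admissible digits, with
  \<open>ln N\<^sub>n \<sim> ln q\<^sub>n\<close>. Write \<open>M\<^sub>k\<close> and \<open>P\<^sub>k\<close> for the products of the first \<open>k\<close> terms of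
  \<open>N\<close> and \<open>q\<close>. Reading the digits of \<open>y \<in> [0,1)\<close> in the bases \<open>N\<^sub>n\<close> as (shifted) digits in
  the bases \<open>q\<^sub>n\<close> gives a map \<open>h\<close> from \<open>[0,1)\<close> into the set. Since \<open>N\<^sub>n \<le> q\<^sub>n\<close>, distances
  between prefixes only grow, so that
  \<open>\<bar>y - z\<bar> M\<^sub>k \<le> P\<^sub>k \<bar>h y - h z\<bar> + 2\<close> for every \<open>k\<close>. The growth hypothesis yields
  \<open>M\<^sub>k \<ge> c P\<^sub>k\<^sub>+\<^sub>1\<^sup>t\<close> for each \<open>t < 1\<close>, hence \<open>\<bar>y - z\<bar> \<le> C \<bar>h y - h z\<bar>\<^sup>t\<close>.
  Pulling a cover of the set back along \<open>h\<close> covers \<open>[0,1)\<close>, and countable subadditivity of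
  Lebesgue measure bounds the \<open>t\<close>-dimensional Hausdorff measure away from 0.
\<close>

section \<open>Hausdorff dimension of subsets of the line\<close>

text \<open>Cutting an interval of length \<open>R\<close> into \<open>n\<close> equal pieces costs
  \<open>R powr t * n powr (1 - t)\<close>, which tends to 0 for \<open>t > 1\<close>.\<close>

lemma hausdorff_measure_eq_0_bounded_real:
  fixes A :: "real set"
  assumes "bounded A" "t > 1"
  shows "hausdorff_measure t A = 0"
proof -
  obtain r where r: "r > 0" "\<And>x. x \<in> A \<Longrightarrow> \<bar>x\<bar> \<le> r"
    using assms(1) unfolding bounded_pos by auto
  define R where "R = 2 * r"
  have R: "R > 0" using r by (simp add: R_def)
  have "hausdorff_premeasure t \<delta> A = 0" if \<delta>: "\<delta> > 0" for \<delta>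
  proof -
    define U where "U n i = (if i < n then {- r + R * real i / real n .. - r + R * real (Suc i) / real n} else {})" for n i :: nat
    have diam: "diameter (U n i) = (if i < n then R / real n else 0)" for n i
    proof (cases "i < n")
      case True
      then have "- r + R * real i / real n \<le> - r + R * real (Suc i) / real n"
        using R by (intro add_left_mono divide_right_mono mult_left_mono) auto
      then show ?thesis using True
        by (simp add: U_def diff_divide_distrib[symmetric] algebra_simps)
    qed (simp add: U_def)
    have cover: "A \<subseteq> (\<Union>i. U n i)" if "n > 0" for n
    proof
      fix x assume x: "x \<in> A"
      have b: "- r \<le> x" "x \<le> r" using r(2)[OF x] by auto
      show "x \<in> (\<Union>i. U n i)"
      \<comment> \<open>At the right endpoint the floor used below would give the index
        \<open>n\<close>, one too many.\<close>
      proof (cases "x = r")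
        case True
        have "x \<in> U n (n - 1)" using that R unfolding U_def True
          by (auto simp: R_def field_simps of_nat_diff)
        then show ?thesis by blast
      next
        case False
        define i where "i = nat \<lfloor>(x + r) * real n / R\<rfloor>"
        have z: "0 \<le> (x + r) * real n / R" using b R by simp
        have "(x + r) * real n / R < real n"
          using b False R that by (simp add: R_def field_simps)
        then have "i < n" using z unfolding i_def by linarith
        moreover have "real i \<le> (x + r) * real n / R" "(x + r) * real n / R \<le> real (Suc i)"
          using z unfolding i_def by linarith+
        then have "R * real i / real n \<le> x + r" "x + r \<le> R * real (Suc i) / real n"
          using R that by (auto simp: field_simps)
        ultimately have "x \<in> U n i" by (simp add: U_def)
        then show ?thesis by blast
      qed
    qed
    have "hausdorff_premeasure t \<delta> A \<le> ennreal (R powr t * real n powr (1 - t))"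
      if n: "n > 0" "R / real n \<le> \<delta>" for n
    proof -
      have "U n \<in> delta_covers \<delta> A"
      proof -
        have "bounded (U n i)" for i by (simp add: U_def)
        then show ?thesis using cover[OF n(1)] n(2) \<delta> by (simp add: delta_covers_def diam)
      qed
      then have "hausdorff_premeasure t \<delta> A \<le> (\<Sum>i. diam_pow t (U n i))"
        unfolding hausdorff_premeasure_def by (rule INF_lower)
      also have "\<dots> = (\<Sum>i<n. diam_pow t (U n i))"
        by (rule suminf_finite) (auto simp: U_def diam_pow_def)
      also have "\<dots> \<le> (\<Sum>i<n. ennreal ((R / real n) powr t))"
        using assms(2) by (intro sum_mono) (auto simp: diam_pow_def diam)
      also have "\<dots> = ennreal (real n * (R / real n) powr t)"
        by (simp add: ennreal_mult ennreal_of_nat_eq_real_of_nat)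
      also have "real n * (R / real n) powr t = R powr t * real n powr (1 - t)"
        using n R by (simp add: powr_divide powr_diff)
      finally show ?thesis .
    qed
    moreover have "eventually (\<lambda>n. n > 0 \<and> R / real n \<le> \<delta>) sequentially"
    proof (intro eventually_conj eventually_gt_at_top)
      have "(\<lambda>n. R / real n) \<longlonglongrightarrow> 0" by (rule lim_const_over_n)
      from order_tendstoD(2)[OF this \<delta>] show "\<forall>\<^sub>F n in sequentially. R / real n \<le> \<delta>"
        by eventually_elim simp
    qed
    ultimately have "eventually (\<lambda>n. hausdorff_premeasure t \<delta> A \<le> ennreal (R powr t * real n powr (1 - t))) sequentially"
      by (auto elim: eventually_mono)
    moreover have "(\<lambda>n. ennreal (R powr t * real n powr (1 - t))) \<longlonglongrightarrow> ennreal (R powr t * 0)"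
      using assms(2)
      by (intro tendsto_ennrealI tendsto_mult tendsto_const tendsto_neg_powr filterlim_real_sequentially) auto
    ultimately have "hausdorff_premeasure t \<delta> A \<le> ennreal (R powr t * 0)"
      by (intro tendsto_lowerbound[OF _ _ trivial_limit_sequentially])
    then show ?thesis by simp
  qed
  then show ?thesis unfolding hausdorff_measure_def by (simp add: SUP_eq_const)
qed

text \<open>The measure vanishes at every exponent \<open>1 + e\<close> but may be positive at 1,
  hence the approach from above.\<close>

lemma hausdorff_dim_bounded_real_le:
  fixes A :: "real set"
  assumes "bounded A"
  shows "hausdorff_dim A \<le> 1"
proof (rule ennreal_le_epsilon)
  fix e :: real assume e: "0 < e"
  have "hausdorff_dim A \<le> ennreal (1 + e)"
    unfolding hausdorff_dim_def
    using hausdorff_measure_eq_0_bounded_real[OF assms, of "1 + e"] e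
    by (intro Inf_lower imageI) simp
  then show "hausdorff_dim A \<le> 1 + ennreal e" using e by (simp add: ennreal_plus)
qed

section \<open>Lower bounds for Hausdorff measure\<close>

lemma hausdorff_measure_empty: "hausdorff_measure t ({} :: 'a::metric_space set) = 0"
proof -
  have "hausdorff_premeasure t \<delta> ({} :: 'a set) \<le> 0" if "\<delta> > 0" for \<delta>
  proof -
    have "(\<lambda>_. {}) \<in> delta_covers \<delta> ({} :: 'a set)" using that by (simp add: delta_covers_def)
    then have "hausdorff_premeasure t \<delta> ({} :: 'a set) \<le> (\<Sum>i. diam_pow t ({} :: 'a set))"
      unfolding hausdorff_premeasure_def by (rule INF_lower)
    then show ?thesis by (simp add: diam_pow_def)
  qed
  then have "hausdorff_measure t ({} :: 'a set) \<le> 0"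
    unfolding hausdorff_measure_def by (intro SUP_least) simp
  then show ?thesis by simp
qed

text \<open>Settles the exponent 0, which the Hoelder criterion below excludes: a cover of a
  nonempty set has a nonempty member, and that counts 1.\<close>

lemma hausdorff_measure_0_pos:
  assumes "A \<noteq> {}"
  shows "hausdorff_measure 0 A \<noteq> 0"
proof -
  have "1 \<le> hausdorff_premeasure 0 1 A"
    unfolding hausdorff_premeasure_def
  proof (rule INF_greatest)
    fix U assume "U \<in> delta_covers 1 A"
    then obtain i where "U i \<noteq> {}" using assms unfolding delta_covers_def by fast
    then have "1 = (\<Sum>i\<in>{i}. diam_pow 0 (U i))" by (simp add: diam_pow_def)
    also have "\<dots> \<le> (\<Sum>i. diam_pow 0 (U i))" by (intro sum_le_suminf) auto
    finally show "1 \<le> (\<Sum>i. diam_pow 0 (U i))" .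
  qed
  also have "\<dots> \<le> hausdorff_measure 0 A"
    unfolding hausdorff_measure_def by (rule SUP_upper) simp
  finally show ?thesis by auto
qed

text \<open>The inverse of \<open>h\<close> is Hoelder of exponent \<open>t\<close>, so a covering
  set of diameter \<open>r\<close> accounts for at most the length \<open>C * r powr t\<close> of
  the unit interval; hence the sum of all \<open>r powr t\<close> is at least
  \<open>1 / C\<close>.\<close>

lemma hausdorff_measure_pos_of_inverse_Hoelder:
  fixes A :: "'a::metric_space set" and h :: "real \<Rightarrow> 'a"
  assumes t: "t > 0" and C: "C > 0"
    and range: "h ` {0..<1} \<subseteq> A"
    and Hoelder: "\<And>y z. y \<in> {0..<1} \<Longrightarrow> z \<in> {0..<1} \<Longrightarrow> y \<le> z \<Longrightarrow> z - y \<le> C * dist (h y) (h z) powr t"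
  shows "hausdorff_measure t A \<noteq> 0"
proof -
  have "ennreal (1 / C) \<le> hausdorff_premeasure t 1 A"
    unfolding hausdorff_premeasure_def
  proof (rule INF_greatest)
    fix U assume U: "U \<in> delta_covers 1 A"
    define W where "W i = {0..<1} \<inter> h -` U i" for i
    \<comment> \<open>\<open>W i\<close> may be non-measurable, so an interval starting at its
      infimum replaces it.\<close>
    define I where "I i = (if W i = {} then {} else {Inf (W i)..Inf (W i) + C * diameter (U i) powr t})" for i
    have WI: "W i \<subseteq> I i" for i
    proof
      fix z assume z: "z \<in> W i"
      have bdd: "bdd_below (W i)" unfolding W_def by (rule bdd_belowI[of _ 0]) auto
      have "Inf (W i) \<le> z" using z bdd by (rule cInf_lower)
      moreover have "z - C * diameter (U i) powr t \<le> Inf (W i)"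
      proof (rule cInf_greatest)
        show "W i \<noteq> {}" using z by blast
        fix y assume y: "y \<in> W i"
        have "dist (h y) (h z) \<le> diameter (U i)"
          using y z U by (intro diameter_bounded_bound) (auto simp: W_def delta_covers_def)
        then have le: "C * dist (h y) (h z) powr t \<le> C * diameter (U i) powr t"
          using t C by (intro mult_left_mono powr_mono2) auto
        \<comment> \<open>Settles the case \<open>z < y\<close>, to which \<open>Hoelder\<close>
          does not apply.\<close>
        have "0 \<le> C * diameter (U i) powr t" using C by simp
        then show "z - C * diameter (U i) powr t \<le> y"
          using Hoelder[of y z] le y z unfolding W_def by (cases "y \<le> z") auto
      qed
      ultimately show "z \<in> I i" using z by (auto simp: I_def)
    qed
    have meas: "emeasure lborel (I i) \<le> ennreal C * diam_pow t (U i)" for i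
    proof (cases "W i = {}")
      case False
      then have "U i \<noteq> {}" by (auto simp: W_def)
      then show ?thesis using False t C by (simp add: I_def diam_pow_def ennreal_mult)
    qed (simp add: I_def)
    have "{0..<1} \<subseteq> (\<Union>i. I i)"
    proof
      fix y :: real assume y: "y \<in> {0..<1}"
      then have "h y \<in> A" using range by blast
      then obtain i where "h y \<in> U i" using U by (auto simp: delta_covers_def)
      then show "y \<in> (\<Union>i. I i)" using WI[of i] y by (auto simp: W_def)
    qed
    then have "emeasure lborel {0..<1::real} \<le> emeasure lborel (\<Union>i. I i)"
      by (intro emeasure_mono) (auto simp: I_def)
    also have "\<dots> \<le> (\<Sum>i. emeasure lborel (I i))"
      by (intro emeasure_subadditive_countably) (auto simp: I_def)
    also have "\<dots> \<le> (\<Sum>i. ennreal C * diam_pow t (U i))"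
      by (intro suminf_le meas) auto
    also have "\<dots> = ennreal C * (\<Sum>i. diam_pow t (U i))" by simp
    finally have "1 \<le> ennreal C * (\<Sum>i. diam_pow t (U i))" by simp
    then have "ennreal (1 / C) * 1 \<le> ennreal (1 / C) * (ennreal C * (\<Sum>i. diam_pow t (U i)))"
      by (rule mult_left_mono) simp
    also have "\<dots> = (\<Sum>i. diam_pow t (U i))"
      using C by (simp add: mult.assoc[symmetric] ennreal_mult[symmetric])
    finally show "ennreal (1 / C) \<le> (\<Sum>i. diam_pow t (U i))" by simp
  qed
  also have "\<dots> \<le> hausdorff_measure t A"
    unfolding hausdorff_measure_def by (rule SUP_upper) simp
  finally show ?thesis using C by (auto simp: ennreal_eq_0_iff)
qed

section \<open>Mixed radix expansions\<close>

text \<open>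
  Bases are indexed from 1. For \<open>0 \<le> y < 1\<close> the prefix is the integer whose expansion in the
  bases \<open>N 1, \<dots>, N n\<close> consists of the first \<open>n\<close> digits of \<open>y\<close>.
\<close>

definition radix_prod :: "(nat \<Rightarrow> nat) \<Rightarrow> nat \<Rightarrow> nat" where
  "radix_prod N n = (\<Prod>k=1..n. N k)"

definition radix_prefix :: "(nat \<Rightarrow> nat) \<Rightarrow> real \<Rightarrow> nat \<Rightarrow> nat" where
  "radix_prefix N y n = nat \<lfloor>y * real (radix_prod N n)\<rfloor>"

definition radix_digit :: "(nat \<Rightarrow> nat) \<Rightarrow> real \<Rightarrow> nat \<Rightarrow> nat" where
  "radix_digit N y n = radix_prefix N y n mod N n"

lemma radix_prod_0 [simp]: "radix_prod N 0 = 1"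
  by (simp add: radix_prod_def)

lemma radix_prod_Suc: "radix_prod N (Suc n) = radix_prod N n * N (Suc n)"
  by (simp add: radix_prod_def)

lemma radix_prod_pos: "(\<And>n. n \<ge> 1 \<Longrightarrow> N n > 0) \<Longrightarrow> radix_prod N n > 0"
  by (induction n) (auto simp: radix_prod_Suc)

text \<open>Dropping the last digit is division by the last base, since integer division of a floor
  is the floor of the quotient.\<close>

lemma radix_prefix_Suc:
  assumes "y \<ge> 0" "N (Suc n) > 0"
  shows "radix_prefix N y (Suc n) = radix_prefix N y n * N (Suc n) + radix_digit N y (Suc n)"
proof -
  let ?x = "y * real (radix_prod N (Suc n))"
  have "\<lfloor>?x\<rfloor> div int (N (Suc n)) = \<lfloor>?x / real_of_int (int (N (Suc n)))\<rfloor>"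
    by (rule floor_divide_real_eq_div[symmetric]) simp
  also have "?x / real_of_int (int (N (Suc n))) = y * real (radix_prod N n)"
    using assms by (simp add: radix_prod_Suc)
  finally have "radix_prefix N y (Suc n) div N (Suc n) = radix_prefix N y n"
    using assms unfolding radix_prefix_def by (simp add: nat_div_distrib[symmetric] nat_div_as_int)
  then show ?thesis unfolding radix_digit_def by (metis div_mult_mod_eq)
qed

lemma radix_prefix_mono: "y \<le> z \<Longrightarrow> radix_prefix N y n \<le> radix_prefix N z n"
  unfolding radix_prefix_def by (intro nat_mono floor_mono mult_right_mono) auto

section \<open>Comparing expansions in two sequences of bases\<close>

text \<open>The prefix difference is nonnegative, so multiplying it by \<open>q (Suc k)\<close>
  instead of \<open>N (Suc k)\<close> can only enlarge it; the new digit difference enters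
  unchanged.\<close>

lemma radix_digit_partial_sums:
  fixes q N :: "nat \<Rightarrow> nat" and y z :: real
  assumes yz: "0 \<le> y" "y \<le> z" "z < 1"
    and N: "\<And>n. n \<ge> 1 \<Longrightarrow> 0 < N n \<and> N n \<le> q n"
  shows "real (radix_prefix N z k) - real (radix_prefix N y k) \<le>
     real (radix_prod q k) * (\<Sum>n=1..k. (real (radix_digit N z n) - real (radix_digit N y n)) / real (radix_prod q n))"
proof (induction k)
  case 0
  then show ?case using yz by (simp add: radix_prefix_def)
next
  case (Suc k)
  let ?p = "\<lambda>k. real (radix_prefix N z k) - real (radix_prefix N y k)"
  let ?d = "\<lambda>n. real (radix_digit N z n) - real (radix_digit N y n)"
  let ?T = "\<Sum>n=1..k. ?d n / real (radix_prod q n)"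
  have q: "q n > 0" if "n \<ge> 1" for n using N[OF that] by linarith
  have Q: "real (radix_prod q (Suc k)) \<noteq> 0" using radix_prod_pos[of q "Suc k"] q by simp
  have "?p (Suc k) = real (N (Suc k)) * ?p k + ?d (Suc k)"
    using yz N[of "Suc k"] by (simp add: radix_prefix_Suc algebra_simps)
  also have "\<dots> \<le> real (q (Suc k)) * ?p k + ?d (Suc k)"
    using N[of "Suc k"] radix_prefix_mono[OF yz(2), of N k]
    by (intro add_right_mono mult_right_mono) auto
  also have "\<dots> \<le> real (q (Suc k)) * (real (radix_prod q k) * ?T) + ?d (Suc k)"
    using Suc by (intro add_right_mono mult_left_mono) auto
  also have "\<dots> = real (radix_prod q (Suc k)) * (?T + ?d (Suc k) / real (radix_prod q (Suc k)))"
    using Q by (simp add: distrib_left) (simp add: radix_prod_Suc)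
  finally show ?case by simp
qed

text \<open>Telescoping: \<open>(q n - 1) / P\<^sub>n\<close> equals
  \<open>1 / P\<^sub>n\<^sub>-\<^sub>1 - 1 / P\<^sub>n\<close>, so the tail after \<open>k\<close>
  is at least \<open>- 1 / P\<^sub>k\<close>.\<close>

lemma radix_series_gap:
  fixes q :: "nat \<Rightarrow> nat" and d :: "nat \<Rightarrow> real"
  assumes q: "\<And>n. n \<ge> 1 \<Longrightarrow> q n > 0"
    and d: "\<And>n. n \<ge> 1 \<Longrightarrow> - d n \<le> real (q n) - 1"
    and sums: "(\<lambda>n. d (Suc n) / real (radix_prod q (Suc n))) sums D"
  shows "(\<Sum>n=1..k. d n / real (radix_prod q n)) - 1 / real (radix_prod q k) \<le> D"
proof -
  let ?T = "\<lambda>k. \<Sum>n=1..k. d n / real (radix_prod q n)"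
  let ?g = "\<lambda>k. ?T k - 1 / real (radix_prod q k)"
  have Q: "radix_prod q n > 0" for n using radix_prod_pos q by blast
  have step: "?g k \<le> ?g (Suc k)" for k
  proof -
    have "1 / real (radix_prod q (Suc k)) - 1 / real (radix_prod q k)
        = - (real (q (Suc k)) - 1) / real (radix_prod q (Suc k))"
      using Q[of k] q[of "Suc k"] by (simp add: radix_prod_Suc field_simps)
    also have "\<dots> \<le> d (Suc k) / real (radix_prod q (Suc k))"
      using d[of "Suc k"] by (intro divide_right_mono) auto
    finally show ?thesis by simp
  qed
  have "?g k \<le> ?T m" if "m \<ge> k" for m
    using lift_Suc_mono_le[of ?g, OF step that] by (smt (verit) of_nat_0_le_iff zero_le_divide_1_iff)
  moreover have "?T \<longlonglongrightarrow> D"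
    using sums unfolding sums_def by (simp add: sum.atLeast1_atMost_eq lessThan_Suc_atMost)
  ultimately show ?thesis by (intro LIMSEQ_le_const) auto
qed

text \<open>The 2 is made of 1 for the tail of the series and 1 for the floor in the prefix of
  \<open>z\<close>.\<close>

lemma radix_gap:
  fixes q N :: "nat \<Rightarrow> nat" and y z :: real
  assumes yz: "0 \<le> y" "y \<le> z" "z < 1"
    and N: "\<And>n. n \<ge> 1 \<Longrightarrow> 0 < N n \<and> N n \<le> q n"
    and sums: "(\<lambda>n. (real (radix_digit N z (Suc n)) - real (radix_digit N y (Suc n))) / real (radix_prod q (Suc n))) sums D"
  shows "(z - y) * real (radix_prod N k) \<le> real (radix_prod q k) * D + 2"
proof -
  let ?d = "\<lambda>n. real (radix_digit N z n) - real (radix_digit N y n)"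
  let ?T = "\<Sum>n=1..k. ?d n / real (radix_prod q n)"
  have q: "q n > 0" if "n \<ge> 1" for n using N[OF that] by linarith
  have Q: "real (radix_prod q k) > 0" using radix_prod_pos[of q k] q by simp
  have "- ?d n \<le> real (q n) - 1" if "n \<ge> 1" for n
  proof -
    have "radix_digit N y n < N n" using N[OF that] by (simp add: radix_digit_def)
    then show ?thesis using N[OF that] by linarith
  qed
  then have "?T - 1 / real (radix_prod q k) \<le> D"
    using q sums by (intro radix_series_gap[where d = ?d])
  then have "real (radix_prod q k) * ?T \<le> real (radix_prod q k) * D + 1"
    using Q by (simp add: field_simps)
  moreover have "real (radix_prefix N z k) - real (radix_prefix N y k) \<le> real (radix_prod q k) * ?T"
    by (rule radix_digit_partial_sums[OF yz N])
  moreover have "z * real (radix_prod N k) - 1 \<le> real (radix_prefix N z k)"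
    "real (radix_prefix N y k) \<le> y * real (radix_prod N k)"
    using yz of_int_floor_le[of "y * real (radix_prod N k)"]
      real_of_int_floor_add_one_ge[of "z * real (radix_prod N k)"]
    unfolding radix_prefix_def by (auto simp: algebra_simps)
  ultimately show ?thesis by (simp add: left_diff_distrib)
qed

lemma radix_prod_gt:
  assumes "\<And>n. n \<ge> 1 \<Longrightarrow> q n \<ge> 2"
  shows "k < radix_prod q k"
proof (induction k)
  case (Suc k)
  have "Suc k < 2 * radix_prod q k" using Suc by simp
  also have "\<dots> \<le> radix_prod q (Suc k)" using assms[of "Suc k"] by (simp add: radix_prod_Suc)
  finally show ?case .
qed simp

section \<open>Hoelder bounds from the growth of the products\<close>

text \<open>For \<open>0 < d < 1\<close> the right scale \<open>k\<close> has
  \<open>1 / P\<^sub>k\<^sub>+\<^sub>1 \<le> d \<le> 1 / P\<^sub>k\<close>. There \<open>gap\<close>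
  gives \<open>w * M\<^sub>k \<le> 3\<close>, and \<open>growth\<close>, which compares
  \<open>M\<^sub>k\<close> with the next product \<open>P\<^sub>k\<^sub>+\<^sub>1\<close>, bounds
  \<open>w\<close> by a multiple of \<open>d powr t\<close>.\<close>

lemma Hoelder_of_radix_gap:
  fixes q N :: "nat \<Rightarrow> nat" and w d c t :: real
  assumes t: "t > 0" and c: "c > 0" and w: "w < 1" and d: "d \<ge> 0"
    and q: "\<And>n. n \<ge> 1 \<Longrightarrow> q n \<ge> 2"
    and growth: "\<And>k. c * real (radix_prod q (Suc k)) powr t \<le> real (radix_prod N k)"
    and gap: "\<And>k. w * real (radix_prod N k) \<le> real (radix_prod q k) * d + 2"
  shows "w \<le> max 1 (3 / c) * d powr t"
proof -
  have Q: "radix_prod q k > 0" for k using radix_prod_gt[of q k, OF q] by simp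
  have Nk: "real (radix_prod N k) > 0" for k
    using growth[of k] c Q[of "Suc k"] by (smt (verit) mult_pos_pos of_nat_0_less_iff powr_gt_zero)
  consider "w \<le> 0" | "w > 0" "d = 0" | "d \<ge> 1" | "0 < d" "d < 1" "w > 0" using d by linarith
  then show ?thesis
  proof cases
    case 1
    have "0 \<le> max 1 (3 / c) * d powr t" using c by (intro mult_nonneg_nonneg) auto
    then show ?thesis using 1 by linarith
  next
    case 2
    \<comment> \<open>This case is contradictory: \<open>M\<^sub>k\<close> is unbounded, but
      \<open>gap\<close> keeps \<open>w * M\<^sub>k\<close> at most 2. \<open>X\<close> solves
      \<open>c * w * X = 2\<close>.\<close>
    define X where "X = 2 / (c * w)"
    have X: "X > 0" using 2 c by (simp add: X_def)
    obtain k :: nat where k: "X powr (1 / t) < real k" using reals_Archimedean2 by blast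
    have "X = (X powr (1 / t)) powr t" using t X by (simp add: powr_powr)
    also have "\<dots> < real (radix_prod q (Suc k)) powr t"
      using t k radix_prod_gt[of q "Suc k"] q by (intro powr_less_mono2) auto
    finally have "c * w * X < c * w * real (radix_prod q (Suc k)) powr t" using c 2 by simp
    also have "\<dots> \<le> w * real (radix_prod N k)" using growth[of k] 2 by (simp add: mult.assoc mult.left_commute)
    also have "\<dots> \<le> 2" using gap[of k] 2 by simp
    finally show ?thesis using c 2 by (simp add: X_def)
  next
    case 3
    \<comment> \<open>The 1 in the constant serves distances \<open>d \<ge> 1\<close>.\<close>
    have "w \<le> 1 * 1" using w by simp
    also have "\<dots> \<le> max 1 (3 / c) * d powr t"
      using 3 t by (intro mult_mono) (auto intro: ge_one_powr_ge_zero)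
    finally show ?thesis .
  next
    case 4
    have ex: "\<exists>k. 1 / real (radix_prod q (Suc k)) \<le> d"
    proof -
      obtain k :: nat where "1 / d < real k" using reals_Archimedean2 by blast
      also have "\<dots> \<le> real (radix_prod q (Suc k))" using radix_prod_gt[of q "Suc k"] q by simp
      finally show ?thesis using 4 Q[of "Suc k"] by (intro exI[of _ k]) (simp add: field_simps)
    qed
    define k where "k = (LEAST k. 1 / real (radix_prod q (Suc k)) \<le> d)"
    have k1: "1 / real (radix_prod q (Suc k)) \<le> d" unfolding k_def using ex by (rule LeastI_ex)
    \<comment> \<open>For \<open>k = 0\<close> the product is 1 and \<open>d < 1\<close> suffices;
      otherwise the minimality of \<open>k\<close> gives the bound.\<close>
    have k2: "real (radix_prod q k) * d \<le> 1"
    proof (cases k)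
      case (Suc i)
      then have "\<not> 1 / real (radix_prod q (Suc i)) \<le> d"
        using not_less_Least[of i "\<lambda>k. 1 / real (radix_prod q (Suc k)) \<le> d"] by (simp add: k_def)
      then show ?thesis using Q[of k] Suc by (simp add: field_simps)
    qed (use 4 in simp)
    have "w * (c * real (radix_prod q (Suc k)) powr t) \<le> w * real (radix_prod N k)"
      using growth 4 by (intro mult_left_mono) auto
    also have "\<dots> \<le> 3" using gap[of k] k2 by simp
    finally have "w \<le> 3 / c * (1 / real (radix_prod q (Suc k))) powr t"
      using c Q[of "Suc k"] by (simp add: powr_divide field_simps)
    also have "\<dots> \<le> max 1 (3 / c) * d powr t"
      using k1 t c by (intro mult_mono powr_mono2) auto
    finally show ?thesis .
  qed
qed

text \<open>Take logarithms, with \<open>a\<close> midway between \<open>t\<close> and 1. By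
  \<open>dense\<close>, \<open>ln M\<^sub>k\<close> is at least \<open>a * ln P\<^sub>k\<close> up
  to a constant, and by \<open>small\<close> the slack \<open>(a - t) * ln P\<^sub>k\<close>
  eventually absorbs the extra term \<open>t * ln (q (Suc k))\<close>.\<close>

lemma radix_prod_growth:
  fixes q N :: "nat \<Rightarrow> nat"
  assumes q: "\<And>n. n \<ge> 1 \<Longrightarrow> q n \<ge> 2" and N: "\<And>n. n \<ge> 1 \<Longrightarrow> N n > 0"
    and small: "(\<lambda>k. ln (real (q k))) \<in> o(\<lambda>k. \<Sum>n=1..k-1. ln (real (q n)))"
    and dense: "\<And>a. a < 1 \<Longrightarrow> eventually (\<lambda>n. a * ln (real (q n)) \<le> ln (real (N n))) sequentially"
    and t: "0 < t" "t < 1"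
  shows "\<exists>c>0. \<forall>k. c * real (radix_prod q (Suc k)) powr t \<le> real (radix_prod N k)"
proof -
  define a where "a = (1 + t) / 2"
  have a: "t < a" "a < 1" using t by (auto simp: a_def)
  have lnq: "0 \<le> ln (real (q n))" if "n \<ge> 1" for n using q[OF that] by simp
  have ln_prod: "ln (real (radix_prod f k)) = (\<Sum>n=1..k. ln (real (f n)))"
    if "\<And>n. n \<ge> 1 \<Longrightarrow> f n > 0" for f k
    unfolding radix_prod_def of_nat_prod by (rule ln_prod) (use that in force)+
  have q0: "q n > 0" if "n \<ge> 1" for n using q[OF that] by simp
  obtain m where m: "\<And>n. n \<ge> m \<Longrightarrow> a * ln (real (q n)) \<le> ln (real (N n))"
    using dense[OF a(2)] unfolding eventually_sequentially by blast
  \<comment> \<open>\<open>g n\<close> is the deficit at position \<open>n\<close>. It vanishes for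
    \<open>n \<ge> m\<close>, so \<open>B\<close> bounds the accumulated deficit for all
    \<open>k\<close>.\<close>
  define g where "g n = max 0 (a * ln (real (q n)) - ln (real (N n)))" for n
  define B where "B = (\<Sum>n=1..m. g n)"
  have B: "a * (\<Sum>n=1..k. ln (real (q n))) - (\<Sum>n=1..k. ln (real (N n))) \<le> B" for k
  proof -
    have "a * (\<Sum>n=1..k. ln (real (q n))) - (\<Sum>n=1..k. ln (real (N n))) \<le> (\<Sum>n=1..k. g n)"
      unfolding sum_distrib_left sum_subtractf[symmetric] by (intro sum_mono) (simp add: g_def)
    also have "\<dots> \<le> (\<Sum>n=1..max k m. g n)" by (intro sum_mono2) (auto simp: g_def)
    also have "\<dots> = (\<Sum>n=1..m. g n)"
      by (intro sum.mono_neutral_right) (use m in \<open>force simp: g_def\<close>)+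
    finally show ?thesis by (simp add: B_def)
  qed
  define f where "f k = t * ln (real (radix_prod q (Suc k))) - ln (real (radix_prod N k))" for k
  have "eventually (\<lambda>k. norm (ln (real (q k))) \<le> (a - t) * norm (\<Sum>n=1..k-1. ln (real (q n)))) sequentially"
    using landau_o.smallD[OF small, of "a - t"] a by simp
  then obtain k0 where k0: "\<And>k. k \<ge> k0 \<Longrightarrow> norm (ln (real (q k))) \<le> (a - t) * norm (\<Sum>n=1..k-1. ln (real (q n)))"
    unfolding eventually_sequentially by blast
  have late: "f k \<le> B" if "k \<ge> k0" for k
  proof -
    have nonneg: "0 \<le> (\<Sum>n=1..k. ln (real (q n)))" by (intro sum_nonneg lnq) auto
    have "t * ln (real (q (Suc k))) \<le> 1 * ln (real (q (Suc k)))"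
      using t lnq[of "Suc k"] by (intro mult_right_mono) auto
    also have "\<dots> \<le> (a - t) * (\<Sum>n=1..k. ln (real (q n)))"
      using k0[of "Suc k"] that nonneg lnq[of "Suc k"] by simp
    finally have "f k \<le> a * (\<Sum>n=1..k. ln (real (q n))) - (\<Sum>n=1..k. ln (real (N n)))"
      using ln_prod[of q "Suc k", OF q0] ln_prod[of N k, OF N] by (simp add: f_def algebra_simps)
    also have "\<dots> \<le> B" by (rule B)
    finally show ?thesis .
  qed
  define B' where "B' = Max (insert B (f ` {..<k0}))"
  have f: "f k \<le> B'" for k
  proof (cases "k < k0")
    case False
    then have "f k \<le> B" by (intro late) simp
    also have "B \<le> B'" unfolding B'_def by (intro Max_ge) auto
    finally show ?thesis .
  qed (auto simp: B'_def intro!: Max_ge)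
  have "exp (- B') * real (radix_prod q (Suc k)) powr t \<le> real (radix_prod N k)" for k
  proof -
    have "exp (- B') * real (radix_prod q (Suc k)) powr t = exp (t * ln (real (radix_prod q (Suc k))) - B')"
      using radix_prod_pos[OF q0, where n = "Suc k"] by (simp add: powr_def exp_diff exp_minus field_simps)
    also have "\<dots> \<le> exp (ln (real (radix_prod N k)))" using f[of k] by (simp add: f_def)
    also have "\<dots> = real (radix_prod N k)" using radix_prod_pos[OF N, where n = k] by simp
    finally show ?thesis .
  qed
  then show ?thesis by (intro exI[of _ "exp (- B')"]) simp
qed

section \<open>The set $\Theta_{Q,S}$\<close>

text \<open>For \<open>j \<ge> 2\<close> the recursion amounts to \<open>blk_end q s j = blk_end q s
  (j - 1) * (2 * j * s j * nu q s (j + 1))\<close>. Thus all of block \<open>Suc j\<close> lies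
  beyond its threshold \<open>nu q s (Suc j)\<close>.\<close>

lemma nu_le_blk_end:
  assumes "basic_sequence s" "infinite_in_limit q" "j \<ge> 1"
  shows "nu q s (Suc j) \<le> blk_end q s j"
proof (cases "j = 1")
  case True
  have "s 1 \<ge> 1" using assms(1) unfolding basic_sequence_def by (metis le_refl le_trans one_le_numeral)
  then show ?thesis using True blk_len_1[of q s] blk_end_Suc[of q s 0]
    by (simp add: Sprod_def numeral_2_eq_2)
next
  case False
  then obtain i where j: "j = Suc i" "i \<ge> 1" using assms(3) by (cases j) auto
  let ?k = "2 * j * s j * nu q s (j + 1)"
  have s: "s j \<ge> 1" using assms(1,3) unfolding basic_sequence_def by (metis le_trans one_le_numeral)
  have i: "blk_end q s i \<ge> 1" using blk_end_props[OF assms(1,2) j(2)] by simp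
  have k: "?k \<ge> nu q s (j + 1)" using s assms(3) by simp
  then have k1: "?k \<ge> 1" using nu_spec[OF assms(2), of s "j + 1"] by linarith
  have "blk_end q s j = blk_end q s i + blk_end q s i * (?k - 1)"
    using Sprod_mult_blk_len[OF assms(1,2), of j] j by (simp add: blk_end_Suc)
  also have "\<dots> = blk_end q s i * (1 + (?k - 1))" by (simp only: distrib_left mult_1_right)
  also have "1 + (?k - 1) = ?k" using k1 by simp
  finally have "blk_end q s j = blk_end q s i * ?k" .
  moreover have "1 * nu q s (j + 1) \<le> blk_end q s i * ?k" using i k by (intro mult_le_mono)
  ultimately show ?thesis by simp
qed

lemma phi_bounds:
  assumes "(j, b, c) \<in> index_set q s"
  shows "blk_end q s (j - 1) < phi q s (j, b, c)" "phi q s (j, b, c) \<le> blk_end q s j"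
proof -
  have "(b - 1) * Sprod s j + c \<le> (b - 1) * Sprod s j + Sprod s j"
    using assms by (simp add: index_set_def)
  also have "\<dots> = b * Sprod s j" using assms by (cases b) (auto simp: index_set_def)
  also have "\<dots> \<le> Sprod s j * blk_len q s j" using assms by (simp add: index_set_def)
  finally show "blk_end q s (j - 1) < phi q s (j, b, c)" "phi q s (j, b, c) \<le> blk_end q s j"
    using assms blk_end_Suc[of q s "j - 1"] by (auto simp: index_set_def phi_def)
qed

text \<open>Block \<open>j\<close> starts after its threshold. The exponent \<open>2 * j\<close>
  ensures that the width \<open>1 / S ^ 2\<close> of \<open>V\<close> costs at most the share
  \<open>1 / j\<close> of \<open>ln q\<close>.\<close>

lemma Sprod_power_le:
  assumes "basic_sequence s" "infinite_in_limit q" "(j, b, c) \<in> index_set q s" "j \<ge> 2"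
  shows "Sprod s j ^ (2 * j) \<le> q (phi q s (j, b, c))"
proof -
  have "nu q s j \<le> blk_end q s (j - 1)"
    using nu_le_blk_end[OF assms(1,2), of "j - 1"] assms(4) by simp
  also have "\<dots> \<le> phi q s (j, b, c)" using phi_bounds(1)[OF assms(3)] by simp
  finally show ?thesis using conjunct2[OF nu_spec[OF assms(2), of s j]] by simp
qed

lemma Sprod_ge_2:
  assumes "basic_sequence s" "j \<ge> 2"
  shows "Sprod s j \<ge> 2"
  using assms(2)
proof (induction j rule: nat_induct_at_least)
  case base
  then show ?case using assms(1) by (simp add: Sprod_def basic_sequence_def numeral_2_eq_2)
next
  case (Suc j)
  have "2 * 1 \<le> Sprod s j * s j"
    using Suc assms(1) by (intro mult_le_mono) (auto simp: basic_sequence_def intro: order_trans[of _ 2])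
  then show ?case using Suc by (simp add: Sprod_Suc)
qed

lemma V_le_3:
  assumes "basic_sequence q" "basic_sequence s" "u \<in> index_set q s" "r \<in> V q s u"
  shows "r \<le> 3"
proof -
  obtain j b c where u: "u = (j, b, c)" by (cases u)
  have c: "c \<le> Sprod s j" using assms(3) by (simp add: u index_set_def)
  have S: "real (Sprod s j) \<ge> 1" using Sprod_pos[OF assms(2), of j] by simp
  show ?thesis
  proof (cases "j = 1")
    case True
    have "phi q s u \<ge> 1" using assms(3) by (simp add: u index_set_def phi_def)
    then have "q (phi q s u) \<ge> 2" using assms(1) by (simp add: basic_sequence_def)
    then have "2 / real (q (phi q s u)) \<le> 2 / 1" by (intro divide_left_mono) auto
    then show ?thesis using assms(4) True by (auto simp: u V_def)
  next
    case False
    have "real c / real (Sprod s j) \<le> 1" using c S by simp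
    moreover have "2 / real (Sprod s j) ^ 2 \<le> 2 / 1"
      using S by (intro divide_left_mono) (auto simp: one_le_power)
    ultimately show ?thesis using assms(4) False by (auto simp: u V_def)
  qed
qed

text \<open>
  The digits admissible at position \<open>n\<close> contain \<open>N\<close> consecutive integers, starting at \<open>B\<close>.
  The digits may exceed \<open>q n\<close> (for \<open>c = Sprod s j\<close>), but the shift by \<open>B\<close> does not
  depend on the point and only \<open>N \<le> q n\<close> matters.
\<close>

lemma admissible_digits:
  assumes bq: "basic_sequence q" and bs: "basic_sequence s" and inf: "infinite_in_limit q"
    and u: "(j, b, c) \<in> index_set q s" and n: "phi q s (j, b, c) = n"
  shows "\<exists>N B. 0 < N \<and> N \<le> q n \<and> B \<ge> 1 \<and>
    (\<forall>e<N. real (B + e) / real (q n) \<in> V q s (j, b, c)) \<and>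
    (1 - 1 / real j) * ln (real (q n)) - ln 2 \<le> ln (real N)"
proof (cases "j = 1")
  case True
  have "n \<ge> 1" using n u by (auto simp: phi_def index_set_def)
  then have q: "q n \<ge> 2" using bq by (simp add: basic_sequence_def)
  \<comment> \<open>In block 1 only the digit 1 is admissible; the factor
    \<open>1 - 1 / real j\<close> is then 0.\<close>
  have "real 1 / real (q n) \<in> V q s (j, b, c)"
    using True q n by (auto simp: V_def intro!: divide_strict_right_mono)
  then show ?thesis using True q by (intro exI[of _ 1]) auto
next
  case False
  then have j: "j \<ge> 2" using u by (auto simp: index_set_def)
  define S where "S = real (Sprod s j)"
  define Q where "Q = real (q n)"
  have S: "S \<ge> 2" using Sprod_ge_2[OF bs j] by (simp add: S_def)
  have SQ: "S ^ (2 * j) \<le> Q"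
    using Sprod_power_le[OF bs inf u j] unfolding n S_def Q_def by (metis of_nat_le_iff of_nat_power)
  have "S ^ 2 \<le> S ^ (2 * j)" using S j by (intro power_increasing) auto
  then have SQ2: "S ^ 2 \<le> Q" using SQ by linarith
  have S2: "S ^ 2 \<ge> 1" using S by (simp add: one_le_power)
  have Q: "Q \<ge> 1" using SQ2 S2 by linarith
  \<comment> \<open>Scaled by \<open>Q\<close>, the interval \<open>V\<close> has length
    \<open>Q / S ^ 2\<close>. Rounding its left end up to \<open>B\<close> loses at most 1, so the
    \<open>N\<close> integers from \<open>B\<close> on still fit.\<close>
  define N where "N = nat \<lfloor>Q / S ^ 2\<rfloor>"
  define B where "B = nat \<lceil>Q * (real c / S + 1 / S ^ 2)\<rceil>"
  have x1: "Q / S ^ 2 \<ge> 1" using SQ2 S by simp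
  then have N1: "N \<ge> 1" "real N \<le> Q / S ^ 2" "Q / S ^ 2 < real N + 1"
    unfolding N_def by linarith+
  have "Q / S ^ 2 \<le> Q / 1" using S2 Q by (intro divide_left_mono) auto
  then have Nq: "N \<le> q n" using N1(2) by (simp add: Q_def)
  have pos: "Q * (real c / S + 1 / S ^ 2) > 0"
    using Q S by (intro mult_pos_pos add_nonneg_pos) auto
  then have B: "B \<ge> 1" "Q * (real c / S + 1 / S ^ 2) \<le> real B" "real B \<le> Q * (real c / S + 1 / S ^ 2) + 1"
    unfolding B_def by linarith+
  have "real (B + e) / Q \<in> V q s (j, b, c)" if "e < N" for e
  proof -
    have "Q * (real c / S + 1 / S ^ 2) \<le> real (B + e)" using B by simp
    moreover have "real (B + e) \<le> Q * (real c / S + 1 / S ^ 2) + Q / S ^ 2"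
      using B(3) N1(2) that by simp
    then have "real (B + e) \<le> Q * (real c / S + 2 / S ^ 2)" by (simp add: algebra_simps)
    ultimately have "real c / S + 1 / S ^ 2 \<le> real (B + e) / Q" "real (B + e) / Q \<le> real c / S + 2 / S ^ 2"
      using Q by (simp_all add: pos_le_divide_eq pos_divide_le_eq mult.commute del: of_nat_add)
    then show ?thesis using False unfolding V_def S_def by (simp del: of_nat_add)
  qed
  moreover have "(1 - 1 / real j) * ln Q - ln 2 \<le> ln (real N)"
  proof -
    \<comment> \<open>\<open>S ^ 2\<close> is at most the \<open>j\<close>-th root of
      \<open>Q\<close>, whence the loss \<open>1 / j\<close>. The \<open>ln 2\<close> pays for the
      floor: \<open>Q / S ^ 2 < N + 1 \<le> 2 * N\<close>.\<close>
    have "real j * ln (S ^ 2) = ln (S ^ (2 * j))" using S by (simp add: ln_realpow)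
    also have "\<dots> \<le> ln Q" using SQ S by (intro ln_mono) auto
    finally have "ln (S ^ 2) \<le> ln Q / real j" using j by (simp add: field_simps)
    then have "(1 - 1 / real j) * ln Q - ln 2 \<le> ln Q - ln (S ^ 2) - ln 2" by (simp add: algebra_simps)
    also have "\<dots> = ln (Q / S ^ 2 / 2)" using Q S by (simp add: ln_div ln_mult)
    also have "\<dots> \<le> ln (real N)"
      using N1 Q S by (intro ln_mono) auto
    finally show ?thesis .
  qed
  ultimately show ?thesis using N1(1) Nq B(1) unfolding Q_def by (intro exI[of _ N] exI[of _ B]) auto
qed

text \<open>Digit over base is at most 3 and the remaining factor at most \<open>(1/2) ^ n\<close>,
  a geometric series with sum 6. This makes the set bounded, as the upper estimate of the dimension
  requires.\<close>

lemma x_of_bounds: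
  assumes "basic_sequence q" "basic_sequence s" "infinite_in_limit q" "F \<in> families q s"
  shows "0 \<le> x_of q s F" "x_of q s F \<le> 6"
proof -
  let ?f = "\<lambda>n. real (digit q s F (Suc n)) / (\<Prod>k=1..Suc n. real (q k))"
  have sm: "summable ?f" by (rule x_of_summable[OF assms])
  show "0 \<le> x_of q s F" unfolding x_of_def using sm by (intro suminf_nonneg) (auto intro!: divide_nonneg_nonneg mult_nonneg_nonneg prod_nonneg)
  have q: "q n \<ge> 2" if "n \<ge> 1" for n using assms(1) that by (simp add: basic_sequence_def)
  have "?f n \<le> 3 * (1/2) ^ n" for n
  proof -
    let ?u = "inv_into (index_set q s) (phi q s) (Suc n)"
    have im: "Suc n \<in> phi q s ` index_set q s"
      using phi_bij[OF assms(2,3)] by (auto simp: bij_betw_def)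
    have u: "?u \<in> index_set q s" "phi q s ?u = Suc n"
      using inv_into_into[OF im] f_inv_into_f[OF im] by auto
    have "real (F ?u) / real (q (Suc n)) \<in> V q s ?u"
      using assms(4) u by (force simp: families_def)
    then have d: "real (digit q s F (Suc n)) / real (q (Suc n)) \<le> 3"
      unfolding digit_def using V_le_3[OF assms(1,2) u(1)] by blast
    have "(2::real) ^ n = (\<Prod>k=1..n. 2)" by simp
    also have "\<dots> \<le> (\<Prod>k=1..n. real (q k))" using q by (intro prod_mono) force
    finally have P: "1 / (\<Prod>k=1..n. real (q k)) \<le> (1/2) ^ n"
      by (simp add: power_one_over frac_le)
    have "?f n = (real (digit q s F (Suc n)) / real (q (Suc n))) * (1 / (\<Prod>k=1..n. real (q k)))"
      by simp
    also have "\<dots> \<le> 3 * (1/2) ^ n"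
      using d P by (intro mult_mono) (auto intro!: prod_nonneg)
    finally show ?thesis .
  qed
  then have "x_of q s F \<le> (\<Sum>n. 3 * (1/2::real) ^ n)"
    unfolding x_of_def using sm by (intro suminf_le summable_mult summable_geometric) auto
  also have "\<dots> = 6" by (simp add: suminf_mult summable_geometric suminf_geometric)
  finally show "x_of q s F \<le> 6" .
qed

section \<open>The map from the unit interval and the conclusion\<close>

lemma hausdorff_measure_Theta_pos:
  fixes q s :: "nat \<Rightarrow> nat"
  assumes bq: "basic_sequence q" and bs: "basic_sequence s" and inf: "infinite_in_limit q"
    and small: "(\<lambda>k. ln (real (q k))) \<in> o(\<lambda>k. \<Sum>n=1..k-1. ln (real (q n)))"
    and t: "0 < t" "t < 1"
  shows "hausdorff_measure t (Theta q s) \<noteq> 0"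
proof -
  define u where "u n = inv_into (index_set q s) (phi q s) n" for n
  have u: "u n \<in> index_set q s" "phi q s (u n) = n" if "n \<ge> 1" for n
  proof -
    have im: "n \<in> phi q s ` index_set q s" using phi_bij[OF bs inf] that by (auto simp: bij_betw_def)
    show "u n \<in> index_set q s" "phi q s (u n) = n"
      using inv_into_into[OF im] f_inv_into_f[OF im] by (auto simp: u_def)
  qed
  have u_phi: "u (phi q s v) = v" if "v \<in> index_set q s" for v
    using phi_bij[OF bs inf] that unfolding u_def bij_betw_def by (intro inv_into_f_f) auto
  have phi_ge: "phi q s v \<ge> 1" if "v \<in> index_set q s" for v
    using phi_bij[OF bs inf] that by (auto simp: bij_betw_def)
  define J where "J n = fst (u n)" for n
  define adm where "adm n N B \<longleftrightarrow> 0 < N \<and> N \<le> q n \<and> B \<ge> 1 \<and>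
    (\<forall>e<N. real (B + e) / real (q n) \<in> V q s (u n)) \<and>
    (1 - 1 / real (J n)) * ln (real (q n)) - ln 2 \<le> ln (real N)" for n N B
  have "\<exists>N B. adm n N B" if n: "n \<ge> 1" for n
  proof -
    obtain j b c where jbc: "u n = (j, b, c)" by (cases "u n")
    show ?thesis
      using admissible_digits[OF bq bs inf u(1)[OF n, unfolded jbc] u(2)[OF n, unfolded jbc]]
      unfolding adm_def J_def jbc fst_conv .
  qed
  then obtain N B where adm: "\<And>n. n \<ge> 1 \<Longrightarrow> adm n (N n) (B n)" by metis
  note NB = adm[unfolded adm_def]
  have N: "0 < N n \<and> N n \<le> q n" if "n \<ge> 1" for n using NB[OF that] by simp
  have q: "q n \<ge> 2" if "n \<ge> 1" for n using bq that by (simp add: basic_sequence_def)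

  have dense: "eventually (\<lambda>n. a * ln (real (q n)) \<le> ln (real (N n))) sequentially" if a: "a < 1" for a
  proof -
    \<comment> \<open>Here \<open>a = 1 - 2 * e\<close>: one \<open>e\<close> absorbs
      \<open>1 / real (J n)\<close>, the other absorbs \<open>ln 2\<close> once
      \<open>ln (real (q n))\<close> is large.\<close>
    define e where "e = (1 - a) / 2"
    have e: "e > 0" using a by (simp add: e_def)
    obtain m :: nat where m: "1 / e < real m" using reals_Archimedean2 by blast
    have mpos: "m > 0" using m e by (cases m) (auto simp: field_simps)
    have "filterlim (\<lambda>n. ln (real (q n))) at_top sequentially"
      using inf unfolding infinite_in_limit_def
      by (rule filterlim_compose[OF ln_at_top filterlim_compose[OF filterlim_real_sequentially]])
    then have "eventually (\<lambda>n. ln 2 / e \<le> ln (real (q n))) sequentially"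
      by (simp add: filterlim_at_top)
    moreover have "eventually (\<lambda>n. n > blk_end q s m) sequentially" by (rule eventually_gt_at_top)
    ultimately show ?thesis
    proof eventually_elim
      case (elim n)
      then have n: "n \<ge> 1" by simp
      obtain j b c where jbc: "u n = (j, b, c)" by (cases "u n")
      \<comment> \<open>Positions beyond the end of block \<open>m\<close> lie in later blocks, and
        \<open>m\<close> exceeds \<open>1 / e\<close>.\<close>
      have "m < j"
      proof (rule ccontr)
        assume "\<not> m < j"
        then have "blk_end q s j \<le> blk_end q s m" unfolding blk_end_def by (intro sum_mono2) auto
        moreover have "n \<le> blk_end q s j" using phi_bounds(2)[of j b c q s] u[OF n] by (simp add: jbc)
        ultimately show False using elim by simp
      qed
      then have "1 / real (J n) \<le> 1 / real m" using mpos by (intro divide_left_mono) (auto simp: J_def jbc)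
      also have "\<dots> \<le> e" using m mpos e by (simp add: field_simps)
      finally have j: "1 - e \<le> 1 - 1 / real (J n)" by simp
      have ln0: "0 \<le> ln (real (q n))" using q[OF n] by simp
      have "a * ln (real (q n)) = (1 - e) * ln (real (q n)) - e * ln (real (q n))"
        by (simp add: e_def field_simps)
      also have "\<dots> \<le> (1 - 1 / real (J n)) * ln (real (q n)) - ln 2"
        using elim(1) e by (intro diff_mono mult_right_mono j ln0) (simp add: field_simps)
      also have "\<dots> \<le> ln (real (N n))" using NB[OF n] by simp
      finally show ?case .
    qed
  qed
  obtain c where c: "c > 0" "\<And>k. c * real (radix_prod q (Suc k)) powr t \<le> real (radix_prod N k)"
    using radix_prod_growth[OF q conjunct1[OF N] small dense t] by auto

  \<comment> \<open>The \<open>n\<close>-th digit of \<open>y\<close> in the bases \<open>N\<close>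
    selects one of the \<open>N n\<close> consecutive admissible values from \<open>B n\<close>
    on.\<close>
  define F where "F y v = B (phi q s v) + radix_digit N y (phi q s v)" for y v
  have F: "F y \<in> families q s" for y
    unfolding families_def
  proof (intro CollectI ballI)
    fix v assume v: "v \<in> index_set q s"
    have "radix_digit N y (phi q s v) < N (phi q s v)"
      using N[OF phi_ge[OF v]] by (simp add: radix_digit_def)
    then show "1 \<le> F y v \<and> real (F y v) / real (q (phi q s v)) \<in> V q s v"
      using NB[OF phi_ge[OF v]] unfolding F_def u_phi[OF v] by (simp del: of_nat_add)
  qed
  have dig: "digit q s (F y) n = B n + radix_digit N y n" if "n \<ge> 1" for y n
    unfolding digit_def using u(2)[OF that] by (simp add: F_def u_def)
  define h where "h y = x_of q s (F y)" for y
  have h: "(\<lambda>n. real (B (Suc n) + radix_digit N y (Suc n)) / real (radix_prod q (Suc n))) sums h y" for y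
    using summable_sums[OF x_of_summable[OF bq bs inf F[of y]]]
    unfolding h_def x_of_def by (simp add: dig radix_prod_def del: of_nat_add)
  have Hoelder: "z - y \<le> max 1 (3 / c) * dist (h y) (h z) powr t"
    if "y \<in> {0..<1}" "z \<in> {0..<1}" "y \<le> z" for y z
  proof (rule Hoelder_of_radix_gap[OF t(1) c(1) _ _ q c(2)])
    fix k
    \<comment> \<open>The shifts \<open>B\<close> cancel in the difference of the two
      series.\<close>
    have "(\<lambda>n. (real (radix_digit N z (Suc n)) - real (radix_digit N y (Suc n))) / real (radix_prod q (Suc n))) sums (h z - h y)"
      using sums_diff[OF h[of z] h[of y]] by (simp add: diff_divide_distrib[symmetric])
    then have "(z - y) * real (radix_prod N k) \<le> real (radix_prod q k) * (h z - h y) + 2"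
      using that by (intro radix_gap N) auto
    also have "\<dots> \<le> real (radix_prod q k) * dist (h y) (h z) + 2"
      by (intro add_right_mono mult_left_mono) (auto simp: dist_real_def)
    finally show "(z - y) * real (radix_prod N k) \<le> real (radix_prod q k) * dist (h y) (h z) + 2" .
  qed (use that in auto)
  have C: "0 < max 1 (3 / c)" by simp
  have "h ` {0..<1} \<subseteq> Theta q s" unfolding h_def Theta_def using F by blast
  from hausdorff_measure_pos_of_inverse_Hoelder[OF t(1) C this Hoelder] show ?thesis .
qed

theorem theorem3p25:
  fixes q s :: "nat \<Rightarrow> nat"
  assumes "basic_sequence q" and "basic_sequence s"
    and "infinite_in_limit q"
    and "(\<lambda>k. ln (real (q k))) \<in> o(\<lambda>k. \<Sum>n=1..k-1. ln (real (q n)))"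
  shows "hausdorff_dim (Theta q s) = 1"
proof (rule antisym)
  have "Theta q s \<subseteq> {0..6}" unfolding Theta_def using x_of_bounds[OF assms(1-3)] by auto
  then have "bounded (Theta q s)" using bounded_closed_interval bounded_subset by blast
  then show "hausdorff_dim (Theta q s) \<le> 1" by (rule hausdorff_dim_bounded_real_le)
  have pos: "hausdorff_measure t (Theta q s) \<noteq> 0" if "0 < t" "t < 1" for t
    using hausdorff_measure_Theta_pos[OF assms that] .
  \<comment> \<open>Nonemptiness follows from positivity at the exponent 1/2 and serves to exclude
    the exponent 0.\<close>
  have "Theta q s \<noteq> {}"
  proof
    assume "Theta q s = {}"
    then show False using pos[of "1/2"] by (simp add: hausdorff_measure_empty)
  qed
  then have pos0: "hausdorff_measure 0 (Theta q s) \<noteq> 0" by (rule hausdorff_measure_0_pos)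
  show "1 \<le> hausdorff_dim (Theta q s)"
    unfolding hausdorff_dim_def
  proof (rule Inf_greatest, clarify)
    fix t :: real assume t: "0 \<le> t" "hausdorff_measure t (Theta q s) = 0"
    then have "t \<noteq> 0" using pos0 by metis
    then have "1 \<le> t" using pos[of t] t by linarith
    then show "1 \<le> ennreal t" by simp
  qed
qed

end
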